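(* There exists a nonempty compact set $X \subset \mathbb{R}^2$ such that for every triangle $T$ with vertices in $X$, the set $X$ is not contained in any translate of $2T$; that is, for all $v_1,v_2,v_3 \in X$ with $T$ the triangle with vertices $v_1,v_2,v_3$, and for all $z \in \mathbb{R}^2$, one has $X \not\subset z + 2T$.
   Context: The triangle (simplex in $\mathbb{R}^2$) with vertices $v_1,v_2,v_3 \in \mathbb{R}^2$ is the convex hull of $v_1,v_2,v_3$; the points are not required to be distinct or affinely independent. For $\lambda \in \mathbb{R}$ and $T \subset \mathbb{R}^2$, $\lambda T = \{\lambda x : x \in T\}$, and a translate of a set $S \subset \mathbb{R}^2$ is a set $z + S = \{z+s : s \in S\}$ with $z \in \mathbb{R}^2$. *)

theory Defs
  imports "HOL-Analysis.Analysis"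
begin

end

theory Submission
  imports Defs
begin

text \<open>
  Suppose that a point set is contained in \<open>z + 2T\<close>, where \<open>T\<close> is the counterclockwise triangle
  \<open>u v w\<close>, and let \<open>p\<close>, \<open>q\<close>, \<open>r\<close> be points of the set. Then the triangles \<open>u p v\<close>, \<open>v q w\<close>,
  \<open>w r u\<close>, erected outwards on the sides of \<open>T\<close>, have total signed area at most the area of \<open>T\<close>.
  For the vertices of a regular pentagon every inscribed triangle violates this bound: the ratio
  of the two areas is \<open>\<surd>5 - 1\<close> for the acute triangles and \<open>(1 + \<surd>5) / 2\<close> for the obtuse ones.
  The strict inequalities survive a perturbation, so that an integral pentagon close to an
  affinely regular one can be used.
\<close>

text \<open>Twice the signed area of the triangle \<open>u v w\<close>, positive for counterclockwise orientation.\<close>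

definition orient :: "real^2 \<Rightarrow> real^2 \<Rightarrow> real^2 \<Rightarrow> real" where
  "orient u v w = (v$1 - u$1) * (w$2 - u$2) - (v$2 - u$2) * (w$1 - u$1)"

lemma orient_rotate: "orient v w u = orient u v w"
  unfolding orient_def by algebra

lemma orient_nonneg_convex_hull:
  assumes "0 \<le> orient u v w" "s \<in> convex hull {u, v, w}"
  shows "0 \<le> orient u v s"
proof -
  obtain a b c where "0 \<le> c" and sum: "a + b + c = 1"
    and s: "s = a *\<^sub>R u + b *\<^sub>R v + c *\<^sub>R w"
    using assms(2) by (auto simp: convex_hull_3)
  have "orient u v s = c * orient u v w"
  proof -
    have a: "a = 1 - b - c" using sum by simp
    show ?thesis
      unfolding orient_def s a by (simp add: algebra_simps)
  qed
  with assms(1) \<open>0 \<le> c\<close> show ?thesis by simp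
qed

text \<open>For any single point, its orientations over the three sides sum to
  \<open>orient u v w\<close>, so \<open>z\<close> cancels.\<close>

lemma orient_sum_le_of_double_triangle:
  assumes "0 \<le> orient u v w"
    and "{p, q, r} \<subseteq> (\<lambda>s. z + s) ` ((\<lambda>x. 2 *\<^sub>R x) ` (convex hull {u, v, w}))"
  shows "orient u p v + orient v q w + orient w r u \<le> orient u v w"
proof -
  obtain p' q' r' where hull: "p' \<in> convex hull {u, v, w}" "q' \<in> convex hull {v, w, u}"
      "r' \<in> convex hull {w, u, v}"
    and eq: "p = z + 2 *\<^sub>R p'" "q = z + 2 *\<^sub>R q'" "r = z + 2 *\<^sub>R r'"
    using assms(2) by (auto simp: insert_commute)
  have "0 \<le> orient u v p'" "0 \<le> orient v w q'" "0 \<le> orient w u r'"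
    using assms(1) hull orient_rotate by (metis orient_nonneg_convex_hull)+
  moreover have "orient u p v + orient v q w + orient w r u
      = orient u v w - 2 * (orient u v p' + orient v w q' + orient w u r')"
    unfolding orient_def eq by (simp add: algebra_simps)
  ultimately show ?thesis by simp
qed

text \<open>\<open>S\<close> admits any vertex order and degenerate triangles.\<close>

lemma not_subset_double_triangle:
  assumes "0 \<le> orient u v w" "orient u v w < orient u p v + orient v q w + orient w r u"
    and "p \<in> X" "q \<in> X" "r \<in> X" "S \<subseteq> {u, v, w}"
  shows "\<not> X \<subseteq> (\<lambda>s. z + s) ` ((\<lambda>x. 2 *\<^sub>R x) ` (convex hull S))"
proof
  assume "X \<subseteq> (\<lambda>s. z + s) ` ((\<lambda>x. 2 *\<^sub>R x) ` (convex hull S))"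
  also have "\<dots> \<subseteq> (\<lambda>s. z + s) ` ((\<lambda>x. 2 *\<^sub>R x) ` (convex hull {u, v, w}))"
    by (intro image_mono hull_mono assms)
  finally have "{p, q, r} \<subseteq> (\<lambda>s. z + s) ` ((\<lambda>x. 2 *\<^sub>R x) ` (convex hull {u, v, w}))"
    using assms(3-5) by auto
  from orient_sum_le_of_double_triangle[OF assms(1) this] assms(2) show False
    by simp
qed

theorem theorem4p1:
  shows "\<exists>X :: (real ^ 2) set. X \<noteq> {} \<and> compact X \<and>
    (\<forall>v1\<in>X. \<forall>v2\<in>X. \<forall>v3\<in>X. \<forall>z :: real ^ 2.
      \<not> X \<subseteq> (\<lambda>s. z + s) ` ((\<lambda>x. 2 *\<^sub>R x) ` (convex hull {v1, v2, v3})))"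
proof -
  \<comment> \<open>An affinely regular pentagon is obtained when \<open>3\<close> is replaced by \<open>1 + \<surd>5\<close>.\<close>
  define A B C D E :: "real^2" where pts:
    "A = vector [0, 0]" "B = vector [2, 0]" "C = vector [3, 2]" "D = vector [2, 3]"
    "E = vector [0, 2]"
  let ?X = "{A, B, C, D, E}"
  note obstruct = not_subset_double_triangle[where X = ?X]
  have "\<not> ?X \<subseteq> (\<lambda>s. z + s) ` ((\<lambda>x. 2 *\<^sub>R x) ` (convex hull {v1, v2, v3}))"
    if vs: "v1 \<in> ?X" "v2 \<in> ?X" "v3 \<in> ?X" for v1 v2 v3 z
  proof -
    let ?S = "{v1, v2, v3}"
    consider "?S \<subseteq> {A, B, C}" | "?S \<subseteq> {A, B, D}" | "?S \<subseteq> {A, B, E}" | "?S \<subseteq> {A, C, D}"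
      | "?S \<subseteq> {A, C, E}" | "?S \<subseteq> {A, D, E}" | "?S \<subseteq> {B, C, D}" | "?S \<subseteq> {B, C, E}"
      | "?S \<subseteq> {B, D, E}" | "?S \<subseteq> {C, D, E}"
      using vs by (elim insertE emptyE) simp_all
    then show ?thesis
    proof cases
      \<comment> \<open>In each case \<open>p\<close>, \<open>q\<close>, \<open>r\<close> are
        vertices farthest beyond the sides \<open>u v\<close>, \<open>v w\<close>,
        \<open>w u\<close>; for an edge of the pentagon an endpoint is taken, contributing
        0.\<close>
      case 1 then show ?thesis
        by (intro obstruct[of A B C A B E]) (auto simp: orient_def pts)
    next
      case 2 then show ?thesis
        by (intro obstruct[of A B D A C E]) (auto simp: orient_def pts)
    next
      case 3 then show ?thesis
        by (intro obstruct[of A B E A C A]) (auto simp: orient_def pts)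
    next
      case 4 then show ?thesis
        by (intro obstruct[of A C D B C E]) (auto simp: orient_def pts)
    next
      case 5 then show ?thesis
        by (intro obstruct[of A C E B D A]) (auto simp: orient_def pts)
    next
      case 6 then show ?thesis
        by (intro obstruct[of A D E B D A]) (auto simp: orient_def pts)
    next
      case 7 then show ?thesis
        by (intro obstruct[of B C D B C A]) (auto simp: orient_def pts)
    next
      case 8 then show ?thesis
        by (intro obstruct[of B C E B D A]) (auto simp: orient_def pts)
    next
      case 9 then show ?thesis
        by (intro obstruct[of B D E C D A]) (auto simp: orient_def pts)
    next
      case 10 then show ?thesis
        by (intro obstruct[of C D E C D A]) (auto simp: orient_def pts)
    qed
  qed
  then show ?thesis
    by (intro exI[of _ ?X]) (auto intro: finite_imp_compact)
qed

end
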